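(* Consider a Boolean control network with $n$ state nodes and $m$ inputs, with algebraic form $x(t+1)=Lu(t)x(t)$, $y(t)=Hx(t)$. Let $P^0=\{s^0_1,\dots,s^0_\alpha\}$ be a set of initial sets and $P^d=\{s^d_1,\dots,s^d_\beta\}$ a set of destination sets, each $s^0_j$ and each $s^d_i$ being a subset of the state space $\Delta_{2^n}$. Let $\mathcal{C}_S=(c_{ij})\in\{0,1\}^{\beta\times\alpha}$ be the corresponding set controllability matrix, $\mathcal{C}_S=J_d^T\times_{\mathcal B}\mathcal{C}\times_{\mathcal B}J_0$. Then: (1) the system is set controllable from $s^0_j$ to $s^d_i$ if and only if $c_{ij}=1$; (2) the system is set controllable at $s^0_j$ if and only if the $j$-th column of $\mathcal{C}_S$ is $\mathbf{1}_\beta$ (the all-ones column of length $\beta$); (3) the system is set controllable if and only if $\mathcal{C}_S=\mathbf{1}_{\beta\times\alpha}$ (the $\beta\times\alpha$ all-ones matrix).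
   Context: Boolean control network: $x_i(t+1)=f_i(x_1(t),\dots,x_n(t);u_1(t),\dots,u_m(t))$, $i=1,\dots,n$, and $y_j(t)=h_j(x_1(t),\dots,x_n(t))$, $j=1,\dots,p$, with all variables in $\mathcal D=\{0,1\}$ and $f_i:\mathcal D^{m+n}\to\mathcal D$, $h_j:\mathcal D^n\to\mathcal D$ arbitrary Boolean functions. Algebraic form: let $\delta_k^i$ be the $i$-th column of the identity matrix $I_k$ and $\Delta_k=\{\delta_k^1,\dots,\delta_k^k\}$. Identify $1\sim\delta_2^1$, $0\sim\delta_2^2$. Products of matrices and vectors are semi-tensor products: for $A$ of size $a\times b$ and $B$ of size $c\times d$, with $t=\mathrm{lcm}(b,c)$, $A\ltimes B=(A\otimes I_{t/b})(B\otimes I_{t/c})$; for column vectors this is the Kronecker product. Put $x(t)=x_1(t)\ltimes\cdots\ltimes x_n(t)\in\Delta_{2^n}$, $u(t)=u_1(t)\ltimes\cdots\ltimes u_m(t)\in\Delta_{2^m}$, $y(t)=y_1(t)\ltimes\cdots\ltimes y_p(t)\in\Delta_{2^p}$. The network is then equivalently written $x(t+1)=Lu(t)x(t)$, $y(t)=Hx(t)$ with unique matrices $L$ of size $2^n\times 2^{n+m}$ and $H$ of size $2^p\times 2^n$, whose columns lie in $\Delta_{2^n}$ and $\Delta_{2^p}$ respectively. Boolean matrix operations: sums and products of $0$-$1$ matrices with addition $\vee$ and multiplication $\wedge$ on entries, written $+_{\mathcal B}$, $\times_{\mathcal B}$; $A^{(k)}$ is the $k$-fold Boolean power. Controllability matrix: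 $M=\sum_{\mathcal B,\,j=1}^{2^m}L\delta_{2^m}^j$ (Boolean sum; $L\delta_{2^m}^j$ is the $j$-th $2^n\times 2^n$ block of $L$), and $\mathcal C=\sum_{\mathcal B,\,i=1}^{2^n}M^{(i)}$. Index vectors and matrices: for $s\subset\Delta_{2^n}$, $V(s)\in\{0,1\}^{2^n}$ has $i$-th entry $1$ if $\delta_{2^n}^i\in s$ and $0$ otherwise. $J_0=[V(s^0_1)\ \cdots\ V(s^0_\alpha)]$ and $J_d=[V(s^d_1)\ \cdots\ V(s^d_\beta)]$. Controllability notions: $x_d$ is controllable from $x_0$ if there are $T>0$ and controls $u(0),\dots,u(T-1)$ driving the trajectory from $x(0)=x_0$ to $x(T)=x_d$. The system is set controllable from $s^0_j$ to $s^d_i$ if there exist $x_0\in s^0_j$ and $x_d\in s^d_i$ such that $x_d$ is controllable from $x_0$; set controllable at $s^0_j$ if it is set controllable from $s^0_j$ to $s^d_i$ for every $s^d_i\in P^d$; set controllable if it is set controllable at every $s^0_j\in P^0$. *)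

theory Defs
  imports "Jordan_Normal_Form.Matrix"
begin

section \<open>Semi-tensor product\<close>

definition kron :: "'a::semiring_1 mat \<Rightarrow> 'a mat \<Rightarrow> 'a mat" where
  "kron A B = mat (dim_row A * dim_row B) (dim_col A * dim_col B)
     (\<lambda>(i, j). A $$ (i div dim_row B, j div dim_col B) * B $$ (i mod dim_row B, j mod dim_col B))"

definition stp :: "'a::semiring_1 mat \<Rightarrow> 'a mat \<Rightarrow> 'a mat"  (infixl "\<ltimes>" 70) where
  "A \<ltimes> B = (let t = lcm (dim_col A) (dim_row B) in
     kron A (1\<^sub>m (t div dim_col A)) * kron B (1\<^sub>m (t div dim_row B)))"

text \<open>Column vectors are matrices with one column, so that they can be factors of \<open>\<ltimes>\<close>.
  The index \<open>i\<close> of \<open>delta k i\<close> is 1-based, as in $\delta_k^i$; matrix entries are 0-based.\<close>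

definition column :: "'a mat \<Rightarrow> nat \<Rightarrow> 'a mat" where
  "column A j = mat_of_cols (dim_row A) [col A j]"

definition delta :: "nat \<Rightarrow> nat \<Rightarrow> nat mat" where
  "delta k i = column (1\<^sub>m k) (i - 1)"

definition Delta :: "nat \<Rightarrow> nat mat set" where
  "Delta k = delta k ` {1..k}"


section \<open>Boolean control networks and their algebraic form\<close>

text \<open>States, inputs and outputs are lists of Booleans; \<open>f i\<close> for \<open>1 \<le> i \<le> n\<close> and \<open>h j\<close> for
  \<open>1 \<le> j \<le> p\<close> are the node and output functions.  Only their values on lists of length \<open>n\<close>
  (states) and \<open>m\<close> (inputs) matter.\<close>

definition next_state ::
  "nat \<Rightarrow> (nat \<Rightarrow> bool list \<Rightarrow> bool list \<Rightarrow> bool) \<Rightarrow> bool list \<Rightarrow> bool list \<Rightarrow> bool list" where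
  "next_state n f x u = map (\<lambda>i. f i x u) [1..<Suc n]"

definition outputs :: "nat \<Rightarrow> (nat \<Rightarrow> bool list \<Rightarrow> bool) \<Rightarrow> bool list \<Rightarrow> bool list" where
  "outputs p h x = map (\<lambda>j. h j x) [1..<Suc p]"

definition vec_bool :: "bool \<Rightarrow> nat mat" where
  "vec_bool b = (if b then delta 2 1 else delta 2 2)"

definition vec_form :: "bool list \<Rightarrow> nat mat" where
  "vec_form xs = foldl (\<ltimes>) (1\<^sub>m 1) (map vec_bool xs)"

definition algebraic_form ::
  "nat \<Rightarrow> nat \<Rightarrow> nat \<Rightarrow> (nat \<Rightarrow> bool list \<Rightarrow> bool list \<Rightarrow> bool) \<Rightarrow> (nat \<Rightarrow> bool list \<Rightarrow> bool)
    \<Rightarrow> nat mat \<Rightarrow> nat mat \<Rightarrow> bool" where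
  "algebraic_form n m p f h L H \<longleftrightarrow>
     L \<in> carrier_mat (2^n) (2^(n + m)) \<and> (\<forall>j < 2^(n + m). column L j \<in> Delta (2^n)) \<and>
     H \<in> carrier_mat (2^p) (2^n) \<and> (\<forall>j < 2^n. column H j \<in> Delta (2^p)) \<and>
     (\<forall>x u. length x = n \<longrightarrow> length u = m \<longrightarrow>
        vec_form (next_state n f x u) = L \<ltimes> vec_form u \<ltimes> vec_form x) \<and>
     (\<forall>x. length x = n \<longrightarrow> vec_form (outputs p h x) = H \<ltimes> vec_form x)"


section \<open>Boolean matrix operations\<close>

definition bool_add :: "nat mat \<Rightarrow> nat mat \<Rightarrow> nat mat"  (infixl "+\<^sub>B" 65) where
  "A +\<^sub>B B = mat (dim_row A) (dim_col A) (\<lambda>(i, j). of_bool (A $$ (i, j) = 1 \<or> B $$ (i, j) = 1))"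

definition bool_mult :: "nat mat \<Rightarrow> nat mat \<Rightarrow> nat mat"  (infixl "\<times>\<^sub>B" 70) where
  "A \<times>\<^sub>B B = mat (dim_row A) (dim_col B)
     (\<lambda>(i, j). of_bool (\<exists>k < dim_col A. A $$ (i, k) = 1 \<and> B $$ (k, j) = 1))"

primrec bool_power :: "nat mat \<Rightarrow> nat \<Rightarrow> nat mat" where
  "bool_power A 0 = 1\<^sub>m (dim_row A)"
| "bool_power A (Suc k) = bool_power A k \<times>\<^sub>B A"

text \<open>\<open>bool_sum r c F k\<close> is the Boolean sum of the \<open>r \<times> c\<close> matrices \<open>F 1, \<dots>, F k\<close>.\<close>

primrec bool_sum :: "nat \<Rightarrow> nat \<Rightarrow> (nat \<Rightarrow> nat mat) \<Rightarrow> nat \<Rightarrow> nat mat" where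
  "bool_sum r c F 0 = 0\<^sub>m r c"
| "bool_sum r c F (Suc k) = bool_sum r c F k +\<^sub>B F (Suc k)"


section \<open>Controllability matrices\<close>

definition input_sum_matrix :: "nat \<Rightarrow> nat \<Rightarrow> nat mat \<Rightarrow> nat mat" where
  "input_sum_matrix n m L = bool_sum (2^n) (2^n) (\<lambda>j. L \<ltimes> delta (2^m) j) (2^m)"

definition controllability_matrix :: "nat \<Rightarrow> nat \<Rightarrow> nat mat \<Rightarrow> nat mat" where
  "controllability_matrix n m L =
     bool_sum (2^n) (2^n) (\<lambda>i. bool_power (input_sum_matrix n m L) i) (2^n)"

definition index_vector :: "nat \<Rightarrow> nat mat set \<Rightarrow> nat vec" where
  "index_vector n s = vec (2^n) (\<lambda>i. of_bool (delta (2^n) (i + 1) \<in> s))"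

definition index_matrix :: "nat \<Rightarrow> nat mat set list \<Rightarrow> nat mat" where
  "index_matrix n ss = mat_of_cols (2^n) (map (index_vector n) ss)"

definition set_controllability_matrix ::
  "nat \<Rightarrow> nat \<Rightarrow> nat mat \<Rightarrow> nat mat set list \<Rightarrow> nat mat set list \<Rightarrow> nat mat" where
  "set_controllability_matrix n m L s0 sd =
     transpose_mat (index_matrix n sd) \<times>\<^sub>B controllability_matrix n m L \<times>\<^sub>B index_matrix n s0"


section \<open>Controllability notions\<close>

text \<open>Points of $\Delta_{2^n}$ stand for the Boolean states whose vector form they are.\<close>

definition controllable_from ::
  "nat \<Rightarrow> nat \<Rightarrow> (nat \<Rightarrow> bool list \<Rightarrow> bool list \<Rightarrow> bool) \<Rightarrow> nat mat \<Rightarrow> nat mat \<Rightarrow> bool" where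
  "controllable_from n m f x0 xd \<longleftrightarrow>
     (\<exists>T > 0. \<exists>x u. length (x 0) = n \<and> vec_form (x 0) = x0 \<and>
        (\<forall>t < T. length (u t) = m \<and> x (Suc t) = next_state n f (x t) (u t)) \<and>
        vec_form (x T) = xd)"

definition set_controllable_from_to ::
  "nat \<Rightarrow> nat \<Rightarrow> (nat \<Rightarrow> bool list \<Rightarrow> bool list \<Rightarrow> bool) \<Rightarrow> nat mat set \<Rightarrow> nat mat set \<Rightarrow> bool" where
  "set_controllable_from_to n m f s0 sd \<longleftrightarrow> (\<exists>x0 \<in> s0. \<exists>xd \<in> sd. controllable_from n m f x0 xd)"

definition set_controllable_at ::
  "nat \<Rightarrow> nat \<Rightarrow> (nat \<Rightarrow> bool list \<Rightarrow> bool list \<Rightarrow> bool) \<Rightarrow> nat mat set set \<Rightarrow> nat mat set \<Rightarrow> bool" where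
  "set_controllable_at n m f Pd s0 \<longleftrightarrow> (\<forall>sd \<in> Pd. set_controllable_from_to n m f s0 sd)"

definition set_controllable ::
  "nat \<Rightarrow> nat \<Rightarrow> (nat \<Rightarrow> bool list \<Rightarrow> bool list \<Rightarrow> bool) \<Rightarrow> nat mat set set \<Rightarrow> nat mat set set \<Rightarrow> bool" where
  "set_controllable n m f P0 Pd \<longleftrightarrow> (\<forall>s0 \<in> P0. set_controllable_at n m f Pd s0)"

end

(* The (a, b) entry of M says that some input drives the b-th state to the a-th state in one step,
   so the Boolean powers of M count steps, and by the pigeonhole principle walks of length at most
   2^n already realise every reachable pair of states. Hence an entry of C_S, a Boolean product with
   index vectors, asserts that some state of s_i^d is reachable from some state of s_j^0. *)

theory Submission
  imports Defs
begin

section \<open>Walks in finite relations\<close>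

text \<open>Pigeonhole: the \<open>k\<close> points after the start lie in \<open>V\<close>, so two
  of them coincide and the loop between them can be cut out. Leaving the start out of the count
  keeps the shortened walk at positive length.\<close>

lemma relpow_shorten:
  assumes "finite V" and "R \<subseteq> V \<times> V" and "(x, y) \<in> R ^^ k" and "k > card V"
  shows "\<exists>l. 0 < l \<and> l < k \<and> (x, y) \<in> R ^^ l"
proof -
  obtain g where g: "g 0 = x" "g k = y" "\<And>i. i < k \<Longrightarrow> (g i, g (Suc i)) \<in> R"
    using assms(3) unfolding relpow_fun_conv by blast
  have V: "g ` {1..k} \<subseteq> V"
  proof
    fix v assume "v \<in> g ` {1..k}"
    then obtain i where i: "1 \<le> i" "i \<le> k" "v = g i" by auto
    then show "v \<in> V" using g(3)[of "i - 1"] assms(2) by (cases i) auto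
  qed
  have "\<not> inj_on g {1..k}"
    using card_inj_on_le[OF _ V assms(1)] assms(4) by auto
  then obtain a b where ab: "1 \<le> a" "a < b" "b \<le> k" "g a = g b"
    by (auto simp: inj_on_def) (metis nat_neq_iff)
  have 1: "(x, g a) \<in> R ^^ a"
    unfolding relpow_fun_conv by (rule exI[of _ g]) (use g ab in auto)
  have 2: "(g b, y) \<in> R ^^ (k - b)"
    unfolding relpow_fun_conv by (rule exI[of _ "\<lambda>i. g (b + i)"]) (use g ab in auto)
  have "(x, y) \<in> R ^^ (a + (k - b))"
    using 1 2 ab(4) by (auto simp: relpow_add)
  then show ?thesis using ab by (intro exI[of _ "a + (k - b)"]) auto
qed

text \<open>A shortest walk of positive length cannot be shortened further, which bounds its length
  by \<open>card V\<close>.\<close>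

lemma trancl_iff_relpow_le_card:
  assumes "finite V" and "R \<subseteq> V \<times> V"
  shows "(x, y) \<in> R\<^sup>+ \<longleftrightarrow> (\<exists>k \<in> {1..card V}. (x, y) \<in> R ^^ k)"
proof
  assume "(x, y) \<in> R\<^sup>+"
  then have ex: "\<exists>k. 0 < k \<and> (x, y) \<in> R ^^ k" by (simp add: trancl_power)
  define k where "k = (LEAST k. 0 < k \<and> (x, y) \<in> R ^^ k)"
  have k: "0 < k" "(x, y) \<in> R ^^ k" using LeastI_ex[OF ex] by (auto simp: k_def)
  have "k \<le> card V"
  proof (rule ccontr)
    assume "\<not> k \<le> card V"
    then obtain l where "0 < l" "l < k" "(x, y) \<in> R ^^ l"
      using relpow_shorten[OF assms k(2)] by auto
    then show False using not_less_Least k_def by blast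
  qed
  then show "\<exists>k \<in> {1..card V}. (x, y) \<in> R ^^ k" using k by (intro bexI[of _ k]) auto
qed (auto simp: trancl_power Suc_le_eq)


section \<open>Semi-tensor products with canonical vectors\<close>

lemma delta_Suc_eq:
  assumes "i < k"
  shows "delta k (Suc i) = mat k 1 (\<lambda>(r, c). of_bool (r = i))"
  using assms unfolding delta_def column_def
  by (intro eq_matI) (auto simp: mat_of_cols_index)

lemma kron_one_right: "kron A (1\<^sub>m (Suc 0)) = A"
  unfolding kron_def by (intro eq_matI) auto

text \<open>The product selects the block number \<open>b\<close> of \<open>q\<close> consecutive
  columns. With \<open>q = 2 ^ n\<close> this isolates the block of \<open>L\<close> for one input;
  with \<open>q = 1\<close> it picks a single column.\<close>

lemma stp_delta:
  assumes A: "A \<in> carrier_mat r (l * q)" and "b < l" and "q > 0"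
  shows "A \<ltimes> delta l (Suc b) = mat r q (\<lambda>(i, k). A $$ (i, b * q + k))"
proof -
  have l: "l > 0" using assms by auto
  \<comment> \<open>The left factor is thus padded by an identity of size 1, the right one by an
    identity of size \<open>q\<close>.\<close>
  have lcm: "lcm (l * q) l = l * q" by (simp add: lcm_proj1_if_dvd)
  have dims: "dim_col A = l * q" "dim_row A = r" using A by auto
  have dd: "dim_row (delta l (Suc b)) = l" "dim_col (delta l (Suc b)) = 1"
    using assms by (simp_all add: delta_Suc_eq)
  have "A \<ltimes> delta l (Suc b) = A * kron (delta l (Suc b)) (1\<^sub>m q)"
    unfolding stp_def Let_def dims dd lcm using l \<open>q > 0\<close> by (simp add: kron_one_right)
  also have "\<dots> = mat r q (\<lambda>(i, k). A $$ (i, b * q + k))"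
  proof (rule eq_matI)
    fix i k assume "i < dim_row (mat r q (\<lambda>(i, k). A $$ (i, b * q + k)))"
      and "k < dim_col (mat r q (\<lambda>(i, k). A $$ (i, b * q + k)))"
    then have ik: "i < r" "k < q" by auto
    have bq: "b * q + k < l * q"
    proof -
      have "b * q + k < Suc b * q" using ik by simp
      also have "\<dots> \<le> l * q" using assms(2) by (intro mult_right_mono) auto
      finally show ?thesis .
    qed
    \<comment> \<open>Column \<open>k\<close> of the padded vector is a unit vector; quotient and
      remainder by \<open>q\<close> locate its nonzero row.\<close>
    have entry: "kron (delta l (Suc b)) (1\<^sub>m q) $$ (s, k) = of_bool (s = b * q + k)"
      if "s < l * q" for s
    proof -
      have sl: "s div q < l" using that by (simp add: less_mult_imp_div_less)
      have "s = b * q + k \<longleftrightarrow> s div q = b \<and> s mod q = k"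
        using ik div_mult_mod_eq[of s q] by auto
      then show ?thesis
        using that sl ik assms unfolding kron_def by (auto simp: delta_Suc_eq)
    qed
    have "(A * kron (delta l (Suc b)) (1\<^sub>m q)) $$ (i, k)
        = (\<Sum>s<l * q. A $$ (i, s) * kron (delta l (Suc b)) (1\<^sub>m q) $$ (s, k))"
      using ik dims dd by (simp add: scalar_prod_def kron_def lessThan_atLeast0)
    also have "\<dots> = (\<Sum>s<l * q. A $$ (i, s) * of_bool (s = b * q + k))"
      by (rule sum.cong) (auto simp: entry)
    also have "\<dots> = A $$ (i, b * q + k)"
      using bq by (simp add: of_bool_def if_distrib cong: if_cong)
    finally show "(A * kron (delta l (Suc b)) (1\<^sub>m q)) $$ (i, k)
        = mat r q (\<lambda>(i, k). A $$ (i, b * q + k)) $$ (i, k)"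
      using ik by simp
  qed (use dims dd in \<open>auto simp: kron_def\<close>)
  finally show ?thesis .
qed

text \<open>Here the left factor has one column, so it is the one that gets padded, and the
  positions combine as the digits \<open>a\<close> and \<open>b\<close> of a mixed radix
  number.\<close>

lemma delta_stp_delta:
  assumes a: "a < k" and b: "b < l"
  shows "delta k (Suc a) \<ltimes> delta l (Suc b) = delta (k * l) (Suc (a * l + b))"
proof -
  have l: "l > 0" using b by auto
  have bl: "a * l + b < k * l"
  proof -
    have "a * l + b < Suc a * l" using b by simp
    also have "\<dots> \<le> k * l" using a by (intro mult_right_mono) auto
    finally show ?thesis .
  qed
  have dd: "dim_row (delta l (Suc b)) = l" "dim_col (delta k (Suc a)) = 1"
    using a b by (simp_all add: delta_Suc_eq)
  have "delta k (Suc a) \<ltimes> delta l (Suc b) = kron (delta k (Suc a)) (1\<^sub>m l) * delta l (Suc b)"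
    unfolding stp_def Let_def dd using l by (simp add: kron_one_right)
  also have "\<dots> = delta (k * l) (Suc (a * l + b))"
  proof (rule eq_matI)
    fix i j assume "i < dim_row (delta (k * l) (Suc (a * l + b)))"
      and "j < dim_col (delta (k * l) (Suc (a * l + b)))"
    then have i: "i < k * l" and j: "j = 0" using bl by (auto simp: delta_Suc_eq)
    have il: "i div l < k" using i by (simp add: less_mult_imp_div_less)
    have "i = a * l + b \<longleftrightarrow> i div l = a \<and> i mod l = b"
      using b div_mult_mod_eq[of i l] by auto
    then show "(kron (delta k (Suc a)) (1\<^sub>m l) * delta l (Suc b)) $$ (i, j)
        = delta (k * l) (Suc (a * l + b)) $$ (i, j)"
      using i j il a b bl l
      by (auto simp: scalar_prod_def kron_def delta_Suc_eq of_bool_def if_distrib cong: if_cong)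
  qed (use a b bl in \<open>auto simp: kron_def delta_Suc_eq\<close>)
  finally show ?thesis .
qed


section \<open>Positions of Boolean states\<close>

text \<open>The 0-based position in $\Delta_{2^n}$; since \<open>True\<close> is $\delta_2^1$, the binary digits are
  complemented.\<close>

definition state_index :: "bool list \<Rightarrow> nat" where
  "state_index xs = foldl (\<lambda>a b. 2 * a + of_bool (\<not> b)) 0 xs"

lemma state_index_snoc: "state_index (xs @ [b]) = 2 * state_index xs + of_bool (\<not> b)"
  by (simp add: state_index_def)

lemma state_index_less: "state_index xs < 2 ^ length xs"
  by (induction xs rule: rev_induct) (auto simp: state_index_snoc, simp add: state_index_def)

lemma vec_bool_eq: "vec_bool b = delta 2 (Suc (of_bool (\<not> b)))"
  by (simp add: vec_bool_def numeral_2_eq_2)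

text \<open>Appending a Boolean multiplies by a vector of length 2 on the right, which doubles the
  position and adds the new digit.\<close>

lemma vec_form_eq: "vec_form xs = delta (2 ^ length xs) (Suc (state_index xs))"
proof (induction xs rule: rev_induct)
  case Nil
  have "1\<^sub>m 1 = delta 1 (Suc 0)" by (subst delta_Suc_eq) (auto intro!: eq_matI)
  then show ?case by (simp add: vec_form_def state_index_def)
next
  case (snoc b xs)
  have "vec_form (xs @ [b]) = delta (2 ^ length xs) (Suc (state_index xs)) \<ltimes> vec_bool b"
    using snoc by (simp add: vec_form_def)
  then show ?case
    by (simp add: vec_bool_eq delta_stp_delta[OF state_index_less] state_index_snoc mult.commute)
qed

lemma state_index_surj:
  assumes "i < 2 ^ n"
  shows "\<exists>xs. length xs = n \<and> state_index xs = i"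
  using assms
proof (induction n arbitrary: i)
  case 0
  then show ?case by (simp add: state_index_def)
next
  case (Suc n)
  then obtain xs where "length xs = n" "state_index xs = i div 2"
    by (metis less_mult_imp_div_less mult.commute power_Suc)
  then show ?case
    \<comment> \<open>Digits are complemented, so an even \<open>i\<close> ends in
      \<open>True\<close>.\<close>
    by (intro exI[of _ "xs @ [even i]"]) (auto simp: state_index_snoc)
qed

text \<open>Translates the summation index of a Boolean product, or the number of an input block,
  into a Boolean list.\<close>

lemma ex_less_pow2_iff: "(\<exists>i < 2 ^ n. P i) \<longleftrightarrow> (\<exists>xs. length xs = n \<and> P (state_index xs))"
  using state_index_surj state_index_less by metis

lemma state_index_inj:
  assumes "length xs = length ys" and "state_index xs = state_index ys"
  shows "xs = ys"
  using assms
proof (induction ys arbitrary: xs rule: rev_induct)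
  case (snoc b ys)
  then obtain a zs where "xs = zs @ [a]" "length zs = length ys"
    by (metis length_append_singleton length_Suc_conv_rev)
  moreover from this snoc.prems have "a = b" "state_index zs = state_index ys"
    by (auto simp: state_index_snoc of_bool_def split: if_splits) presburger+
  ultimately show ?case using snoc.IH by simp
qed simp


section \<open>Boolean sums and powers\<close>

lemma bool_sum_dims [simp]:
  "dim_row (bool_sum r c F k) = r" "dim_col (bool_sum r c F k) = c"
  by (induction k) (auto simp: bool_add_def)

lemma bool_sum_entry:
  assumes "i < r" and "j < c"
  shows "bool_sum r c F k $$ (i, j) = 1 \<longleftrightarrow> (\<exists>l \<in> {1..k}. F l $$ (i, j) = 1)"
proof (induction k)
  case (Suc k)
  then show ?case
    using assms by (auto simp: bool_add_def atLeastAtMostSuc_conv)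
qed (use assms in simp)

lemma bool_power_dims [simp]:
  assumes "dim_col A = dim_row A"
  shows "dim_row (bool_power A k) = dim_row A" "dim_col (bool_power A k) = dim_row A"
  using assms by (induction k) (auto simp: bool_mult_def)

lemma bool_mult_entry:
  assumes "i < dim_row A" and "j < dim_col B"
  shows "(A \<times>\<^sub>B B) $$ (i, j) = 1 \<longleftrightarrow> (\<exists>k < dim_col A. A $$ (i, k) = 1 \<and> B $$ (k, j) = 1)"
  using assms by (simp add: bool_mult_def)


section \<open>Reachability\<close>

text \<open>The state transition graph with the inputs forgotten. The length conditions confine it
  to finitely many vertices, as the pigeonhole argument requires.\<close>

definition step_rel ::
  "nat \<Rightarrow> nat \<Rightarrow> (nat \<Rightarrow> bool list \<Rightarrow> bool list \<Rightarrow> bool) \<Rightarrow> (bool list \<times> bool list) set" where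
  "step_rel n m f = {(x, next_state n f x u) | x u. length x = n \<and> length u = m}"

lemma length_next_state [simp]: "length (next_state n f x u) = n"
  by (simp add: next_state_def)

lemma step_rel_subset: "step_rel n m f \<subseteq> {x. length x = n} \<times> {x. length x = n}"
  by (auto simp: step_rel_def)

text \<open>A controlled trajectory is a walk in the transition graph; \<open>T > 0\<close> makes
  the closure transitive but not reflexive.\<close>

lemma controllable_from_iff:
  "controllable_from n m f x0 xd \<longleftrightarrow>
     (\<exists>x y. length x = n \<and> length y = n \<and> vec_form x = x0 \<and> vec_form y = xd
        \<and> (x, y) \<in> (step_rel n m f)\<^sup>+)" (is "_ \<longleftrightarrow> ?R")
proof
  assume "controllable_from n m f x0 xd"
  then obtain T x u where *: "T > 0" "length (x 0) = n" "vec_form (x 0) = x0" "vec_form (x T) = xd"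
    and step: "\<And>t. t < T \<Longrightarrow> length (u t) = m \<and> x (Suc t) = next_state n f (x t) (u t)"
    unfolding controllable_from_def by blast
  have len: "length (x t) = n" if "t \<le> T" for t
    using that step * by (cases t) auto
  have "(x t, x (Suc t)) \<in> step_rel n m f" if "t < T" for t
    using step[OF that] len[of t] that unfolding step_rel_def by auto
  then have "(x 0, x T) \<in> step_rel n m f ^^ T"
    unfolding relpow_fun_conv by blast
  then have "(x 0, x T) \<in> (step_rel n m f)\<^sup>+"
    using * by (auto simp: trancl_power)
  then show ?R using * len by blast
next
  assume ?R
  then obtain x y where *: "length x = n" "vec_form x = x0" "vec_form y = xd"
    and "(x, y) \<in> (step_rel n m f)\<^sup>+" by blast
  then obtain T where T: "T > 0" "(x, y) \<in> step_rel n m f ^^ T"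
    by (auto simp: trancl_power)
  then obtain g where g: "g 0 = x" "g T = y" "\<And>t. t < T \<Longrightarrow> (g t, g (Suc t)) \<in> step_rel n m f"
    unfolding relpow_fun_conv by blast
  \<comment> \<open>Placing \<open>t < T\<close> under the existential quantifier makes the choice
    of inputs total; values from \<open>T\<close> on are arbitrary.\<close>
  have "\<forall>t. \<exists>u. t < T \<longrightarrow> length u = m \<and> g (Suc t) = next_state n f (g t) u"
    using g(3) unfolding step_rel_def by blast
  then obtain u where "\<And>t. t < T \<Longrightarrow> length (u t) = m \<and> g (Suc t) = next_state n f (g t) (u t)"
    by metis
  then show "controllable_from n m f x0 xd"
    unfolding controllable_from_def using T g * by blast
qed

section \<open>Entries of the one-step matrix, its powers and the controllability matrix\<close>

text \<open>Multiplying \<open>L\<close> by the input selects a block, and multiplying by the state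
  selects a column of it; by the algebraic form that column is the unit vector of the
  successor.\<close>

lemma next_state_entry:
  assumes "algebraic_form n m p f h L H" and "length x = n" and "length u = m" and "i < 2 ^ n"
  shows "(L \<ltimes> delta (2 ^ m) (Suc (state_index u))) $$ (i, state_index x)
       = of_bool (i = state_index (next_state n f x u))"
proof -
  have L: "L \<in> carrier_mat (2 ^ n) (2 ^ m * 2 ^ n)"
    and eq: "vec_form (next_state n f x u) = L \<ltimes> vec_form u \<ltimes> vec_form x"
    using assms unfolding algebraic_form_def by (auto simp: power_add mult.commute)
  let ?B = "L \<ltimes> delta (2 ^ m) (Suc (state_index u))"
  have u: "state_index u < 2 ^ m" using state_index_less[of u] assms by simp
  have x: "state_index x < 2 ^ n" using state_index_less[of x] assms by simp
  have y: "state_index (next_state n f x u) < 2 ^ n"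
    using state_index_less[of "next_state n f x u"] by simp
  \<comment> \<open>The factor 1 lets \<open>stp_delta\<close> apply again with
    \<open>q = 1\<close>.\<close>
  have B: "?B \<in> carrier_mat (2 ^ n) (2 ^ n * 1)"
    by (simp add: stp_delta[OF L u])
  have "vec_form (next_state n f x u) $$ (i, 0)
      = (?B \<ltimes> delta (2 ^ n) (Suc (state_index x))) $$ (i, 0)"
    using eq assms by (simp add: vec_form_eq)
  also have "\<dots> = ?B $$ (i, state_index x)"
    using assms(4) by (simp add: stp_delta[OF B x])
  finally show ?thesis
    using assms(4) y by (simp add: vec_form_eq delta_Suc_eq)
qed

lemma input_sum_matrix_dims [simp]:
  "dim_row (input_sum_matrix n m L) = 2 ^ n" "dim_col (input_sum_matrix n m L) = 2 ^ n"
  by (simp_all add: input_sum_matrix_def)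

text \<open>Columns stand for sources and rows for targets, so the matrix is the transposed
  adjacency matrix of the transition graph.\<close>

lemma input_sum_matrix_entry:
  assumes "algebraic_form n m p f h L H" and "length x = n" and "length y = n"
  shows "input_sum_matrix n m L $$ (state_index y, state_index x) = 1
     \<longleftrightarrow> (x, y) \<in> step_rel n m f"
proof -
  have x: "state_index x < 2 ^ n" using state_index_less[of x] assms by simp
  have y: "state_index y < 2 ^ n" using state_index_less[of y] assms by simp
  have "input_sum_matrix n m L $$ (state_index y, state_index x) = 1
    \<longleftrightarrow> (\<exists>l \<in> {1..2 ^ m}. (L \<ltimes> delta (2 ^ m) l) $$ (state_index y, state_index x) = 1)"
    unfolding input_sum_matrix_def by (rule bool_sum_entry[OF y x])
  also have "\<dots> \<longleftrightarrow> (\<exists>l < 2 ^ m. (L \<ltimes> delta (2 ^ m) (Suc l)) $$ (state_index y, state_index x) = 1)"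
    \<comment> \<open>Passes from the 1-based block numbers to 0-based input positions.\<close>
    unfolding image_Suc_lessThan[symmetric] by auto
  also have "\<dots> \<longleftrightarrow> (\<exists>u. length u = m \<and> state_index y = state_index (next_state n f x u))"
    unfolding ex_less_pow2_iff
    by (intro ex_cong1 conj_cong refl) (simp_all add: next_state_entry[OF assms(1,2) _ y] del: One_nat_def)
  also have "\<dots> \<longleftrightarrow> (x, y) \<in> step_rel n m f"
  proof -
    have "state_index y = state_index (next_state n f x u) \<longleftrightarrow> y = next_state n f x u" for u
      using state_index_inj[of y "next_state n f x u"] assms(3) by auto
    then show ?thesis using assms(2) by (auto simp: step_rel_def)
  qed
  finally show ?thesis .
qed

lemma bool_power_entry:
  assumes "algebraic_form n m p f h L H" and "length x = n" and "length y = n"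
  shows "bool_power (input_sum_matrix n m L) k $$ (state_index y, state_index x) = 1
     \<longleftrightarrow> (x, y) \<in> step_rel n m f ^^ k"
  using assms(2,3)
proof (induction k arbitrary: x y)
  case 0
  have "state_index x < 2 ^ n" "state_index y < 2 ^ n"
    using state_index_less[of x] state_index_less[of y] 0 by simp_all
  then show ?case using 0 state_index_inj[of y x] by auto
next
  case (Suc k)
  have x: "state_index x < 2 ^ n" and y: "state_index y < 2 ^ n"
    using state_index_less[of x] state_index_less[of y] Suc by simp_all
  have "bool_power (input_sum_matrix n m L) (Suc k) $$ (state_index y, state_index x) = 1
    \<longleftrightarrow> (\<exists>l < 2 ^ n. bool_power (input_sum_matrix n m L) k $$ (state_index y, l) = 1
          \<and> input_sum_matrix n m L $$ (l, state_index x) = 1)"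
    using x y by (simp add: bool_mult_entry del: One_nat_def)
  also have "\<dots> \<longleftrightarrow> (\<exists>z. length z = n \<and> (z, y) \<in> step_rel n m f ^^ k \<and> (x, z) \<in> step_rel n m f)"
    unfolding ex_less_pow2_iff
    using Suc.prems
    by (intro ex_cong1 conj_cong refl) (simp_all add: Suc.IH input_sum_matrix_entry[OF assms(1)] del: One_nat_def)
  also have "\<dots> \<longleftrightarrow> (x, y) \<in> step_rel n m f ^^ Suc k"
  proof -
    \<comment> \<open>Since columns are sources, the right factor of \<open>bool_power\<close> is
      the first step of the walk, whereas \<open>relpow\<close> adds its new step at the
      end.\<close>
    have "step_rel n m f ^^ Suc k = step_rel n m f O step_rel n m f ^^ k"
      by (simp add: relpow_commute)
    then show ?thesis using step_rel_subset[of n m f] by blast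
  qed
  finally show ?case .
qed

text \<open>There are \<open>2 ^ n\<close> states, so the Boolean sum runs over exactly the walk
  lengths that suffice for the transitive closure.\<close>

lemma controllability_matrix_entry:
  assumes "algebraic_form n m p f h L H" and "length x = n" and "length y = n"
  shows "controllability_matrix n m L $$ (state_index y, state_index x) = 1
     \<longleftrightarrow> (x, y) \<in> (step_rel n m f)\<^sup>+"
proof -
  have x: "state_index x < 2 ^ n" and y: "state_index y < 2 ^ n"
    using state_index_less[of x] state_index_less[of y] assms by simp_all
  have fin: "finite {x :: bool list. length x = n}"
    and card: "card {x :: bool list. length x = n} = 2 ^ n"
    using finite_lists_length_eq[of "UNIV :: bool set" n]
      card_lists_length_eq[of "UNIV :: bool set" n] by simp_all
  show ?thesis
    unfolding controllability_matrix_def bool_sum_entry[OF y x] bool_power_entry[OF assms]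
      trancl_iff_relpow_le_card[OF fin step_rel_subset] card ..
qed

section \<open>Index matrices and the set controllability matrix\<close>

lemma index_matrix_dims [simp]:
  "dim_row (index_matrix n ss) = 2 ^ n" "dim_col (index_matrix n ss) = length ss"
  by (simp_all add: index_matrix_def)

lemma index_matrix_entry:
  assumes "length x = n" and "j < length ss"
  shows "index_matrix n ss $$ (state_index x, j) = of_bool (vec_form x \<in> ss ! j)"
  using assms state_index_less[of x]
  by (simp add: index_matrix_def mat_of_cols_index index_vector_def vec_form_eq)

lemma set_controllability_matrix_dims [simp]:
  "dim_row (set_controllability_matrix n m L s0 sd) = length sd"
  "dim_col (set_controllability_matrix n m L s0 sd) = length s0"
  by (simp_all add: set_controllability_matrix_def bool_mult_def)

text \<open>The two Boolean products become nested existential quantifiers: the inner one over a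
  destination state, the outer one over an initial state.\<close>

lemma set_controllability_matrix_entry:
  assumes "algebraic_form n m p f h L H" and i: "i < length sd" and j: "j < length s0"
  shows "set_controllability_matrix n m L s0 sd $$ (i, j) = 1
     \<longleftrightarrow> set_controllable_from_to n m f (s0 ! j) (sd ! i)"
proof -
  let ?C = "controllability_matrix n m L"
  let ?D = "transpose_mat (index_matrix n sd)"
  have dims: "dim_row ?D = length sd" "dim_col ?D = 2 ^ n" "dim_col ?C = 2 ^ n"
    "dim_row (?D \<times>\<^sub>B ?C) = length sd" "dim_col (?D \<times>\<^sub>B ?C) = 2 ^ n"
    by (simp_all add: bool_mult_def controllability_matrix_def)
  have D: "?D $$ (i, state_index y) = of_bool (vec_form y \<in> sd ! i)" if "length y = n" for y
    using that i state_index_less[of y] by (simp add: index_matrix_entry)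
  \<comment> \<open>Row \<open>i\<close> of this partial product marks the states from which the set
    \<open>sd ! i\<close> can be reached.\<close>
  have DC: "(?D \<times>\<^sub>B ?C) $$ (i, state_index x) = 1
    \<longleftrightarrow> (\<exists>y. length y = n \<and> vec_form y \<in> sd ! i \<and> (x, y) \<in> (step_rel n m f)\<^sup>+)"
    if x: "length x = n" for x
  proof -
    have "(?D \<times>\<^sub>B ?C) $$ (i, state_index x) = 1
      \<longleftrightarrow> (\<exists>k < 2 ^ n. ?D $$ (i, k) = 1 \<and> ?C $$ (k, state_index x) = 1)"
      using i x state_index_less[of x] dims by (subst bool_mult_entry) simp_all
    also have "\<dots> \<longleftrightarrow> (\<exists>y. length y = n \<and> vec_form y \<in> sd ! i \<and> (x, y) \<in> (step_rel n m f)\<^sup>+)"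
      unfolding ex_less_pow2_iff
      by (intro ex_cong1 conj_cong refl)
        (simp_all add: D controllability_matrix_entry[OF assms(1) x] del: One_nat_def)
    finally show ?thesis .
  qed
  have "set_controllability_matrix n m L s0 sd $$ (i, j) = 1
    \<longleftrightarrow> (\<exists>k < 2 ^ n. (?D \<times>\<^sub>B ?C) $$ (i, k) = 1 \<and> index_matrix n s0 $$ (k, j) = 1)"
    unfolding set_controllability_matrix_def using i j dims by (subst bool_mult_entry) simp_all
  also have "\<dots> \<longleftrightarrow> (\<exists>x. length x = n \<and> vec_form x \<in> s0 ! j
      \<and> (\<exists>y. length y = n \<and> vec_form y \<in> sd ! i \<and> (x, y) \<in> (step_rel n m f)\<^sup>+))"
    unfolding ex_less_pow2_iff
    by (rule ex_cong1, rule conj_cong[OF refl])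
      (use DC index_matrix_entry[OF _ j] in \<open>auto simp del: One_nat_def\<close>)
  also have "\<dots> \<longleftrightarrow> set_controllable_from_to n m f (s0 ! j) (sd ! i)"
    unfolding set_controllable_from_to_def controllable_from_iff by auto
  finally show ?thesis .
qed

theorem mainTheorem1:
  fixes n m p :: nat
    and f :: "nat \<Rightarrow> bool list \<Rightarrow> bool list \<Rightarrow> bool"
    and h :: "nat \<Rightarrow> bool list \<Rightarrow> bool"
    and L H CS :: "nat mat"
    and P0 Pd :: "nat mat set set"
    and s0 sd :: "nat mat set list"
  assumes "algebraic_form n m p f h L H"
    and "P0 = set s0" and "Pd = set sd"
    and "\<forall>s \<in> P0. s \<subseteq> Delta (2^n)" and "\<forall>s \<in> Pd. s \<subseteq> Delta (2^n)"
    and "CS = set_controllability_matrix n m L s0 sd"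
  shows "(\<forall>i < length sd. \<forall>j < length s0.
            set_controllable_from_to n m f (s0 ! j) (sd ! i) \<longleftrightarrow> CS $$ (i, j) = 1)
       \<and> (\<forall>j < length s0.
            set_controllable_at n m f Pd (s0 ! j) \<longleftrightarrow> col CS j = vec (length sd) (\<lambda>_. 1))
       \<and> (set_controllable n m f P0 Pd \<longleftrightarrow> CS = mat (length sd) (length s0) (\<lambda>_. 1))"
proof -
  have dims: "dim_row CS = length sd" "dim_col CS = length s0"
    using assms(6) by simp_all
  have entry: "set_controllable_from_to n m f (s0 ! j) (sd ! i) \<longleftrightarrow> CS $$ (i, j) = 1"
    if "i < length sd" "j < length s0" for i j
    using set_controllability_matrix_entry[OF assms(1) that] assms(6) by simp
  \<comment> \<open>Quantifying over the members of \<open>Pd\<close> amounts to quantifying over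
    positions in \<open>sd\<close>, that is, over rows; a set listed twice only repeats a
    row.\<close>
  have at: "set_controllable_at n m f Pd (s0 ! j) \<longleftrightarrow> (\<forall>i < length sd. CS $$ (i, j) = 1)"
    if "j < length s0" for j
    unfolding set_controllable_at_def assms(3) all_set_conv_all_nth using entry that by simp
  have "set_controllable_at n m f Pd (s0 ! j) \<longleftrightarrow> col CS j = vec (length sd) (\<lambda>_. 1)"
    if "j < length s0" for j
    using at[OF that] dims that by (auto simp: vec_eq_iff)
  moreover have "set_controllable n m f P0 Pd \<longleftrightarrow> CS = mat (length sd) (length s0) (\<lambda>_. 1)"
    unfolding set_controllable_def assms(2) all_set_conv_all_nth
    using at dims by (auto simp: mat_eq_iff)
  ultimately show ?thesis using entry by blast
qed

end
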